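(* Let $Q\in\mathbb{R}[X_1,\dots,X_n]$ be an arbitrary symmetric polynomial, i.e. $Q(X_1,\dots,X_n)=Q(X_{\sigma(1)},\dots,X_{\sigma(n)})$ for every permutation $\sigma\in S_n$. Then the Kalman gain $K^*$ is a critical point of the map $\mathbb{R}^{n\times m}\to\mathbb{R}$, $K\mapsto Q(\lambda_1^K,\dots,\lambda_n^K)$.
   Context: Let $P\in\mathbb{R}^{n\times n}$ (prior covariance) and $R\in\mathbb{R}^{m\times m}$ (likelihood covariance) be symmetric and positive definite, and let $H\in\mathbb{R}^{m\times n}$ (measurement operator). The Kalman gain is $K^*=PH^\top(HPH^\top+R)^{-1}\in\mathbb{R}^{n\times m}$. For $K\in\mathbb{R}^{n\times m}$ set $P_K=(I-KH)P(I-KH)^\top+KRK^\top$, where $I$ is the $n\times n$ identity matrix; $P_K$ is symmetric and positive definite, and $P_{K^*}$ is the posterior covariance. Let $0<\lambda_1^K\le\dots\le\lambda_n^K$ be the eigenvalues of $P_K$ with multiplicity. A critical point of a real-valued function of $K$ is a point where its derivative with respect to $K$ exists and vanishes. *)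

theory Defs
  imports "HOL-Analysis.Analysis" "HOL-Library.Poly_Mapping"
    "HOL-Computational_Algebra.Polynomial"
begin

section \<open>Matrices\<close>

definition sym_pos_def :: "real ^ 'n ^ 'n \<Rightarrow> bool" where
  "sym_pos_def A \<longleftrightarrow> transpose A = A \<and> (\<forall>x. x \<noteq> 0 \<longrightarrow> x \<bullet> (A *v x) > 0)"

definition charpoly :: "real ^ 'n ^ 'n \<Rightarrow> real poly" where
  "charpoly A = det (mat [:0, 1:] - (\<chi> i j. [:A $ i $ j:]))"

text \<open>
  The real eigenvalues in nondecreasing order, each repeated according to its algebraic
  multiplicity. For symmetric \<open>A\<close>, all roots of the characteristic polynomial are real, so the
  list has length \<open>CARD('n)\<close>, and algebraic and geometric multiplicities agree.
\<close>
definition eigenvalues :: "real ^ 'n ^ 'n \<Rightarrow> real list" where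
  "eigenvalues A = sorted_list_of_multiset (proots (charpoly A))"


section \<open>Kalman gain\<close>

definition kalman_gain ::
  "real ^ 'n ^ 'n \<Rightarrow> real ^ 'm ^ 'm \<Rightarrow> real ^ 'n ^ 'm \<Rightarrow> real ^ 'm ^ 'n" where
  "kalman_gain P R H = P ** transpose H ** matrix_inv (H ** P ** transpose H + R)"

definition updated_cov ::
  "real ^ 'n ^ 'n \<Rightarrow> real ^ 'm ^ 'm \<Rightarrow> real ^ 'n ^ 'm \<Rightarrow> real ^ 'm ^ 'n \<Rightarrow> real ^ 'n ^ 'n" where
  "updated_cov P R H K =
     (mat 1 - K ** H) ** P ** transpose (mat 1 - K ** H) + K ** R ** transpose K"


section \<open>Multivariate polynomials\<close>

text \<open>
  Polynomials are finitely supported maps from monomials to coefficients, a monomial being a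
  finitely supported map from variable indices to exponents; addition and multiplication are
  those of \<open>\<Rightarrow>\<^sub>0\<close> (the product is convolution). The variables \<open>X\<^sub>1, \<dots>, X\<^sub>n\<close> have indices \<open>0, \<dots>, n - 1\<close>.
\<close>
type_synonym 'a mpoly = "(nat \<Rightarrow>\<^sub>0 nat) \<Rightarrow>\<^sub>0 'a"

definition mpoly_const :: "'a \<Rightarrow> 'a::zero mpoly" where
  "mpoly_const c = Poly_Mapping.single 0 c"

definition mpoly_var :: "nat \<Rightarrow> 'a::zero_neq_one mpoly" where
  "mpoly_var i = Poly_Mapping.single (Poly_Mapping.single i 1) 1"

definition mpoly_vars :: "'a::zero mpoly \<Rightarrow> nat set" where
  "mpoly_vars Q = (\<Union>m\<in>Poly_Mapping.keys Q. Poly_Mapping.keys m)"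

text \<open>
  Substitution of \<open>f i\<close> for the \<open>i\<close>-th variable, with values in a ring into which the coefficients
  are mapped by \<open>c\<close>. It serves both for evaluation at real numbers and for permuting variables.
\<close>
definition mpoly_subst ::
  "('a::zero \<Rightarrow> 'b::comm_semiring_1) \<Rightarrow> (nat \<Rightarrow> 'b) \<Rightarrow> 'a mpoly \<Rightarrow> 'b" where
  "mpoly_subst c f Q =
     (\<Sum>m\<in>Poly_Mapping.keys Q. c (Poly_Mapping.lookup Q m) *
        (\<Prod>i\<in>Poly_Mapping.keys m. f i ^ Poly_Mapping.lookup m i))"

definition mpoly_eval :: "'a::comm_semiring_1 mpoly \<Rightarrow> (nat \<Rightarrow> 'a) \<Rightarrow> 'a" where
  "mpoly_eval Q x = mpoly_subst (\<lambda>a. a) x Q"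

definition symmetric_mpoly :: "nat \<Rightarrow> 'a::comm_semiring_1 mpoly \<Rightarrow> bool" where
  "symmetric_mpoly n Q \<longleftrightarrow>
     (\<forall>\<sigma>. \<sigma> permutes {..<n} \<longrightarrow> mpoly_subst mpoly_const (\<lambda>i. mpoly_var (\<sigma> i)) Q = Q)"


section \<open>Critical points\<close>

definition critical_point :: "('a::real_normed_vector \<Rightarrow> real) \<Rightarrow> 'a \<Rightarrow> bool" where
  "critical_point f x \<longleftrightarrow> (f has_derivative (\<lambda>_. 0)) (at x)"

end

theory Submission
  imports Defs
begin

text \<open>
  Each single eigenvalue, taken by its position in the nondecreasing order, has derivative zero at the
  Kalman gain, and a polynomial in such functions inherits this.
  
  Write \<open>G\<close> for the gain and \<open>S = H ** P ** transpose H + R\<close>. Completing the square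
  (\<open>updated_cov_eq_at_gain_plus_congruence\<close>) shows that the updated covariance at \<open>K\<close> differs from the one
  at \<open>G\<close> by exactly \<open>(K - G) ** S ** transpose (K - G)\<close>, a symmetric matrix whose quadratic form is bounded by a
  constant times \<open>(norm (K - G))\<^sup>2 * (x \<bullet> x)\<close>. In general an ordered eigenvalue is only a Lipschitz function of
  a symmetric matrix and may fail to be differentiable where eigenvalues collide. But a Lipschitz function of
  something that moves to second order also moves to second order, so its derivative exists and
  vanishes, whatever the multiplicities. The polynomial in the eigenvalues then has derivative zero by
  the chain rule.
  
  The Lipschitz bound is Weyl's inequality, here in the one-sided form
  \<open>eigenvalues_le_if_quadratic_form_le\<close>. It rests on the spectral theorem
  (\<open>symmetric_matrix_orthonormal_eigenvectors\<close>) together with the identification of the roots of the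
  characteristic polynomial, counted with multiplicity, with the eigenvalues of an orthonormal
  eigenbasis (\<open>charpoly_of_orthonormal_eigenvectors\<close>).
\<close>

section \<open>The spectral theorem for real symmetric matrices\<close>

lemma inner_symmetric_matrix:
  fixes A :: "real ^ 'n ^ 'n"
  assumes "transpose A = A"
  shows "x \<bullet> (A *v y) = (A *v x) \<bullet> y"
  by (metis assms dot_lmul_matrix vector_transpose_matrix)

text \<open>
  The Rayleigh quotient attains its maximum \<open>l\<close> on the compact unit sphere of \<open>S\<close>. At a maximizer
  \<open>v\<close> the form \<open>g y = l * (y \<bullet> y) - y \<bullet> (A *v y)\<close>, which is nonnegative on \<open>S\<close>, vanishes, so its
  first variation there vanishes as well; in the direction \<open>w = l *\<^sub>R v - A *v v\<close>, which lies in \<open>S\<close>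
  by invariance, that first variation is \<open>2 * (w \<bullet> w)\<close>.
\<close>
lemma unit_eigenvector_in_invariant_subspace:
  fixes A :: "real ^ 'n ^ 'n"
  assumes sym: "transpose A = A" and S: "subspace S" "S \<noteq> {0}"
    and inv: "\<And>x. x \<in> S \<Longrightarrow> A *v x \<in> S"
  obtains v l where "v \<in> S" "norm v = 1" "A *v v = l *\<^sub>R v"
proof -
  note sym_inner = inner_symmetric_matrix[OF sym]
  define T where "T = S \<inter> sphere 0 1"
  have "compact T"
    unfolding T_def using S(1) by (intro closed_Int_compact closed_subspace) auto
  moreover obtain x where x: "x \<in> S" "x \<noteq> 0"
    using S subspace_0 by blast
  then have "(1 / norm x) *\<^sub>R x \<in> T"
    unfolding T_def using S(1) by (auto intro: subspace_scale)
  then have "T \<noteq> {}" by blast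
  moreover have "continuous_on T (\<lambda>x. x \<bullet> (A *v x))"
    by (intro continuous_intros linear_continuous_on matrix_vector_mul_bounded_linear)
  ultimately obtain v where v: "v \<in> T" and max: "\<And>y. y \<in> T \<Longrightarrow> y \<bullet> (A *v y) \<le> v \<bullet> (A *v v)"
    using continuous_attains_sup by metis
  define l where "l = v \<bullet> (A *v v)"
  have vS: "v \<in> S" and nv: "norm v = 1" using v by (auto simp: T_def)
  define g where "g y = l * (y \<bullet> y) - y \<bullet> (A *v y)" for y
  have g_nonneg: "g y \<ge> 0" if "y \<in> S" for y
  proof (cases "y = 0")
    case False
    have "(1 / norm y) *\<^sub>R y \<in> T"
      unfolding T_def using S(1) that False by (auto intro: subspace_scale)
    from max[OF this] False show ?thesis
      by (simp add: g_def l_def matrix_vector_mult_scaleR divide_simps dot_square_norm power2_eq_square)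
  qed (simp add: g_def)
  define w where "w = l *\<^sub>R v - A *v v"
  define a where "a = w \<bullet> w"
  define b where "b = g w"
  have wS: "w \<in> S" unfolding w_def using S(1) vS inv by (auto intro: subspace_diff subspace_scale)
  then have b: "b \<ge> 0" unfolding b_def by (rule g_nonneg)
  have expand: "g (v + t *\<^sub>R w) = 2 * t * a + t\<^sup>2 * b" for t
  proof -
    have "g (v + t *\<^sub>R w) = g v + 2 * t * (l * (v \<bullet> w) - (A *v v) \<bullet> w) + t\<^sup>2 * g w"
      using sym_inner[of v w] inner_commute[of w v] inner_commute[of w "A *v v"]
      by (simp add: g_def algebra_simps inner_add power2_eq_square)
    moreover have "g v = 0" using nv by (simp add: g_def l_def dot_square_norm)
    moreover have "l * (v \<bullet> w) - (A *v v) \<bullet> w = a"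
      unfolding a_def by (subst (3) w_def) (simp add: inner_diff_left)
    ultimately show ?thesis by (simp add: b_def)
  qed
  \<comment> \<open>A step against \<open>w\<close>, small enough that the term linear in the step dominates the quadratic one.\<close>
  have "v + (- a / (b + 1)) *\<^sub>R w \<in> S"
    using S(1) vS wS by (intro subspace_add subspace_scale)
  from g_nonneg[OF this] have "0 \<le> 2 * (- a / (b + 1)) * a + (- a / (b + 1))\<^sup>2 * b"
    by (simp only: expand)
  also have "\<dots> = - (a\<^sup>2 * (b + 2)) / (b + 1)\<^sup>2"
    using b by (simp add: divide_simps) (simp add: power2_eq_square algebra_simps)
  finally have "a\<^sup>2 * (b + 2) \<le> 0"
    using b by (simp add: divide_simps split: if_splits)
  then have "a = 0" using b by (smt (verit) mult_pos_pos zero_less_power2)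
  then have "A *v v = l *\<^sub>R v" by (simp add: a_def w_def)
  then show thesis using that vS nv by blast
qed

text \<open>
  A unit eigenvector \<open>v\<close> is split off: by symmetry its orthogonal complement within \<open>S\<close> is again
  invariant and has dimension one less.
\<close>
lemma orthonormal_eigenbasis_of_invariant_subspace:
  fixes A :: "real ^ 'n ^ 'n"
  assumes sym: "transpose A = A" and "subspace S" and "\<And>x. x \<in> S \<Longrightarrow> A *v x \<in> S"
  shows "\<exists>B. B \<subseteq> S \<and> pairwise orthogonal B \<and> (\<forall>v\<in>B. norm v = 1 \<and> (\<exists>l. A *v v = l *\<^sub>R v))
             \<and> card B = dim S"
  using assms(2,3)
proof (induction "dim S" arbitrary: S rule: less_induct)
  case less
  show ?case
  proof (cases "S = {0}")
    case True
    then show ?thesis by (intro exI[of _ "{}"]) auto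
  next
    case False
    then obtain v l where v: "v \<in> S" "norm v = 1" "A *v v = l *\<^sub>R v"
      using unit_eigenvector_in_invariant_subspace[OF sym less.prems(1)] less.prems(2) by blast
    define S' where "S' = S \<inter> {x. v \<bullet> x = 0}"
    have sub': "subspace S'"
      unfolding S'_def using less.prems(1) subspace_hyperplane by (rule subspace_inter)
    have inv': "A *v x \<in> S'" if "x \<in> S'" for x
    proof -
      have "v \<bullet> (A *v x) = (A *v v) \<bullet> x"
        by (rule inner_symmetric_matrix[OF sym])
      then show ?thesis using that v less.prems by (auto simp: S'_def)
    qed
    have "v \<notin> S'" using v by (auto simp: S'_def)
    moreover have "S' \<subseteq> S" by (auto simp: S'_def)
    ultimately have "dim S' < dim S"
      using v(1) less.prems(1) sub' by (metis dim_psubset psubsetI span_eq_iff)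
    from less.hyps[OF this sub' inv'] obtain B where
      B: "B \<subseteq> S'" "pairwise orthogonal B" "\<forall>v\<in>B. norm v = 1 \<and> (\<exists>l. A *v v = l *\<^sub>R v)" "card B = dim S'"
      by blast
    have "dim S \<le> dim S' + 1"
    proof -
      have "x \<in> span (insert v S')" if "x \<in> S" for x
      proof -
        have "x - (v \<bullet> x) *\<^sub>R v \<in> S'"
          using that v less.prems(1)
          by (auto simp: S'_def inner_diff_right dot_square_norm intro: subspace_diff subspace_scale)
        then show ?thesis by (meson insertI2 span_base span_breakdown_eq)
      qed
      then have "dim S \<le> dim (insert v S')" by (metis dim_subset dim_span subsetI)
      then show ?thesis by (simp add: dim_insert split: if_splits)
    qed
    moreover have "finite B"
      using B by (metis norm_zero pairwise_orthogonal_independent finiteI_independent zero_neq_one)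
    moreover have "v \<notin> B" using \<open>v \<notin> S'\<close> B by blast
    ultimately have "card (insert v B) = dim S" using B(4) \<open>dim S' < dim S\<close> by simp
    moreover have "pairwise orthogonal (insert v B)"
      using B(1,2) by (auto simp: pairwise_insert S'_def orthogonal_def inner_commute)
    moreover have "insert v B \<subseteq> S" using v B(1) \<open>S' \<subseteq> S\<close> by blast
    ultimately show ?thesis using v B(3) by (intro exI[of _ "insert v B"]) auto
  qed
qed

lemma symmetric_matrix_orthonormal_eigenvectors:
  fixes A :: "real ^ 'n ^ 'n"
  assumes "transpose A = A"
  obtains f :: "'n \<Rightarrow> real ^ 'n" and d :: "'n \<Rightarrow> real"
  where "\<And>i j. f i \<bullet> f j = (if i = j then 1 else 0)" "\<And>i. A *v f i = d i *\<^sub>R f i"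
proof -
  obtain B where B: "pairwise orthogonal B"
    "\<forall>v\<in>B. norm v = 1 \<and> (\<exists>l. A *v v = l *\<^sub>R v)" "card B = CARD('n)"
    using orthonormal_eigenbasis_of_invariant_subspace[OF assms subspace_UNIV] by auto
  then have "finite B" by (metis card_eq_0_iff zero_less_card_finite less_irrefl)
  then obtain f where f: "bij_betw f (UNIV :: 'n set) B"
    using B(3) finite_same_card_bij[of "UNIV :: 'n set" B] by auto
  then have fB: "f i \<in> B" for i by (auto simp: bij_betw_def)
  then have "\<forall>i. \<exists>l. A *v f i = l *\<^sub>R f i" using B(2) by blast
  then obtain d where d: "\<And>i. A *v f i = d i *\<^sub>R f i" by metis
  have "f i \<bullet> f j = (if i = j then 1 else 0)" for i j
    using B(1,2) fB f by (auto simp: dot_square_norm pairwise_def orthogonal_def bij_betw_def inj_eq)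
  then show thesis using d that by blast
qed

text \<open>
  Diagonalization has to be carried out over the ring of polynomials, in which the entries of the
  characteristic matrix live. With the eigenvectors as the columns of \<open>U\<close>, the relation \<open>A ** U = U ** D\<close>
  gives \<open>(X - A) ** U = U ** (X - D)\<close>, and \<open>det U\<close> can be cancelled because it is a unit.
\<close>
lemma charpoly_of_orthonormal_eigenvectors:
  fixes A :: "real ^ 'n ^ 'n" and f :: "'n \<Rightarrow> real ^ 'n"
  assumes orth: "\<And>i j. f i \<bullet> f j = (if i = j then 1 else 0)"
    and eig: "\<And>i. A *v f i = d i *\<^sub>R f i"
  shows "charpoly A = (\<Prod>i\<in>UNIV. [:- d i, 1:])"
proof -
  \<comment> \<open>The embedding of real matrices into polynomial matrices as constants.\<close>
  define pm :: "real ^ 'n ^ 'n \<Rightarrow> real poly ^ 'n ^ 'n" where "pm M = (\<chi> i j. [:M $ i $ j:])" for M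
  have const_sum: "[:sum h I:] = (\<Sum>i\<in>I. [:h i:])" for h :: "'n \<Rightarrow> real" and I
  proof (induction I rule: infinite_finite_induct)
    case (insert x F)
    have "[:h x + sum h F:] = [:h x:] + [:sum h F:]" by simp
    with insert show ?case by simp
  qed simp_all
  have pm_mult: "pm (M ** N) = pm M ** pm N" for M N
    by (simp add: pm_def matrix_matrix_mult_def vec_eq_iff const_sum mult.commute)
  have pm_one: "pm (mat 1) = mat 1"
    by (simp add: pm_def mat_def vec_eq_iff one_pCons)
  define U :: "real ^ 'n ^ 'n" where "U = (\<chi> i j. f j $ i)"
  define D :: "real ^ 'n ^ 'n" where "D = (\<chi> i j. if i = j then d i else 0)"
  have "transpose U ** U = mat 1"
    using orth by (simp add: matrix_matrix_mult_def transpose_def U_def mat_def vec_eq_iff inner_vec_def)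
  then have "det (pm (transpose U)) * det (pm U) = 1"
    by (metis pm_mult pm_one det_mul det_I)
  then have nz: "det (pm U) \<noteq> 0" by auto
  have AU: "A ** U = U ** D"
  proof -
    have "(A ** U) $ i $ j = (U ** D) $ i $ j" for i j
    proof -
      have "(A ** U) $ i $ j = (A *v f j) $ i"
        by (simp add: matrix_matrix_mult_def matrix_vector_mult_def U_def)
      also have "\<dots> = d j * f j $ i" by (simp add: eig)
      also have "\<dots> = (U ** D) $ i $ j"
        by (simp add: matrix_matrix_mult_def U_def D_def if_distrib cong: if_cong)
      finally show ?thesis .
    qed
    then show ?thesis by (simp add: vec_eq_iff)
  qed
  have mat_comm: "mat c ** M = M ** mat c" for c and M :: "real poly ^ 'n ^ 'n"
    by (simp add: matrix_matrix_mult_def mat_def vec_eq_iff if_distrib if_distribR mult.commute cong: if_cong)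
  have "(mat [:0, 1:] - pm A) ** pm U = pm U ** (mat [:0, 1:] - pm D)"
    using mat_comm[of "[:0,1:]" "pm U"] arg_cong[OF AU, of pm] pm_mult
    by (simp add: matrix_eq matrix_vector_mul_assoc[symmetric] algebra_simps)
  then have "det (mat [:0, 1:] - pm A) * det (pm U) = det (pm U) * det (mat [:0, 1:] - pm D)"
    by (metis det_mul)
  then have "charpoly A = det (mat [:0, 1:] - pm D)"
    using nz by (simp add: charpoly_def pm_def)
  also have "\<dots> = (\<Prod>i\<in>UNIV. [:- d i, 1:])"
    by (subst det_diagonal) (auto simp: mat_def pm_def D_def)
  finally show ?thesis .
qed

section \<open>Monotonicity of the ordered eigenvalues\<close>
lemma mset_eigenvalues:
  fixes A :: "real ^ 'n ^ 'n" and f :: "'n \<Rightarrow> real ^ 'n"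
  assumes "\<And>i j. f i \<bullet> f j = (if i = j then 1 else 0)" and "\<And>i. A *v f i = d i *\<^sub>R f i"
  shows "mset (eigenvalues A) = image_mset d (mset_set UNIV)"
proof -
  have "proots (charpoly A) = (\<Sum>i\<in>UNIV. {#d i#})"
    using charpoly_of_orthonormal_eigenvectors[OF assms] by (simp add: proots_prod)
  also have "(\<Sum>i\<in>I. {#d i#}) = image_mset d (mset_set I)" for I
    by (induction I rule: infinite_finite_induct) auto
  finally show ?thesis by (simp add: eigenvalues_def)
qed

text \<open>
  This turns comparison of ordered eigenvalues into comparison of the numbers of eigenvalues up to a
  threshold, which are dimensions of subspaces.
\<close>
lemma sorted_nth_le_iff_count:
  fixes xs :: "real list"
  assumes "sorted xs" "i < length xs"
  shows "xs ! i \<le> t \<longleftrightarrow> i < size (filter_mset (\<lambda>x. x \<le> t) (mset xs))"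
proof -
  define C where "C = {k. k < length xs \<and> xs ! k \<le> t}"
  have fin: "finite C" by (simp add: C_def)
  have card: "size (filter_mset (\<lambda>x. x \<le> t) (mset xs)) = card C"
    by (simp add: C_def length_filter_conv_card flip: mset_filter)
  show ?thesis
  proof
    assume "xs ! i \<le> t"
    then have "{..i} \<subseteq> C"
      using assms by (auto simp: C_def intro: order_trans[OF sorted_nth_mono])
    from card_mono[OF fin this] card show "i < size (filter_mset (\<lambda>x. x \<le> t) (mset xs))" by simp
  next
    assume less: "i < size (filter_mset (\<lambda>x. x \<le> t) (mset xs))"
    show "xs ! i \<le> t"
    proof (rule ccontr)
      assume "\<not> xs ! i \<le> t"
      have "k < i" if "k \<in> C" for k
        using that \<open>\<not> xs ! i \<le> t\<close> sorted_nth_mono[OF assms(1), of i k] 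
        by (force simp: C_def not_less[symmetric])
      then have "C \<subseteq> {..<i}" by blast
      from card_mono[OF _ this] card less show False by simp
    qed
  qed
qed

lemma quadratic_form_on_span_of_eigenvectors:
  fixes A :: "real ^ 'n ^ 'n" and f :: "'n \<Rightarrow> real ^ 'n"
  assumes orth: "\<And>i j. f i \<bullet> f j = (if i = j then 1 else 0)"
    and eig: "\<And>i. A *v f i = d i *\<^sub>R f i"
    and "x \<in> span (f ` J)"
  obtains c where "x \<bullet> x = (\<Sum>j\<in>J. (c j)\<^sup>2)" "x \<bullet> (A *v x) = (\<Sum>j\<in>J. d j * (c j)\<^sup>2)"
proof -
  have inj: "inj_on f J"
    by (rule inj_onI) (metis orth zero_neq_one)
  obtain u where "x = (\<Sum>v\<in>f ` J. u v *\<^sub>R v)"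
    using assms(3) by (auto simp: span_finite)
  then have x: "x = (\<Sum>j\<in>J. u (f j) *\<^sub>R f j)"
    using inj by (simp add: sum.reindex)
  define c where "c j = u (f j)" for j
  have xA: "A *v x = (\<Sum>j\<in>J. (d j * c j) *\<^sub>R f j)"
    by (simp add: x c_def matrix_vector_mult_scaleR eig mult.commute
        linear_sum[OF matrix_vector_mul_linear])
  have dot: "x \<bullet> (\<Sum>j\<in>J. b j *\<^sub>R f j) = (\<Sum>j\<in>J. c j * b j)" for b
    by (simp add: x inner_sum_left inner_sum_right orth c_def if_distrib mult.commute cong: if_cong)
  have "x \<bullet> x = (\<Sum>j\<in>J. (c j)\<^sup>2)"
    using dot[of c] by (simp add: x c_def power2_eq_square)
  moreover have "x \<bullet> (A *v x) = (\<Sum>j\<in>J. d j * (c j)\<^sup>2)"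
    by (simp add: xA dot power2_eq_square mult_ac)
  ultimately show thesis using that by blast
qed

lemma dim_span_orthonormal:
  fixes f :: "'n \<Rightarrow> 'a::euclidean_space"
  assumes orth: "\<And>i j. f i \<bullet> f j = (if i = j then 1 else 0)"
  shows "dim (span (f ` J)) = card J"
proof -
  have "independent (f ` J)"
  proof (rule pairwise_orthogonal_independent)
    show "pairwise orthogonal (f ` J)"
      using orth by (auto simp: pairwise_def orthogonal_def)
    show "0 \<notin> f ` J" by (metis imageE inner_zero_left orth zero_neq_one)
  qed
  moreover have "inj_on f J" by (rule inj_onI) (metis orth zero_neq_one)
  ultimately show ?thesis by (simp add: dim_eq_card_independent card_image)
qed

lemma length_eigenvalues:
  fixes A :: "real ^ 'n ^ 'n"
  assumes "transpose A = A"
  shows "length (eigenvalues A) = CARD('n)"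
proof -
  obtain f :: "'n \<Rightarrow> real ^ 'n" and d where
    fd: "\<And>i j. f i \<bullet> f j = (if i = j then 1 else 0)" "\<And>i. A *v f i = d i *\<^sub>R f i"
    using symmetric_matrix_orthonormal_eigenvectors[OF assms] by metis
  from arg_cong[OF mset_eigenvalues[OF fd], of size] show ?thesis by simp
qed

text \<open>
  Weyl's monotonicity principle. Put \<open>t = eigenvalues B ! i\<close>. On the span \<open>W\<close> of the eigenvectors of
  \<open>B\<close> with eigenvalue at most \<open>t\<close> the form of \<open>B\<close> is at most \<open>t * (x \<bullet> x)\<close>; on the nonzero vectors of the
  span \<open>V\<close> of the eigenvectors of \<open>A\<close> with eigenvalue above \<open>t + e\<close> the form of \<open>A\<close> exceeds
  \<open>(t + e) * (x \<bullet> x)\<close>. Hence \<open>V\<close> and \<open>W\<close> meet only in \<open>0\<close>, so their dimensions add up to at most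
  \<open>CARD('n)\<close>. As \<open>dim W > i\<close>, this leaves more than \<open>i\<close> eigenvalues of \<open>A\<close> that are at most \<open>t + e\<close>.
\<close>
lemma eigenvalues_le_if_quadratic_form_le:
  fixes A B :: "real ^ 'n ^ 'n"
  assumes symA: "transpose A = A" and symB: "transpose B = B"
    and le: "\<And>x. x \<bullet> (A *v x) \<le> x \<bullet> (B *v x) + e * (x \<bullet> x)"
    and i: "i < CARD('n)"
  shows "eigenvalues A ! i \<le> eigenvalues B ! i + e"
proof -
  obtain f :: "'n \<Rightarrow> real ^ 'n" and d where
    f: "\<And>i j. f i \<bullet> f j = (if i = j then 1 else 0)" "\<And>i. A *v f i = d i *\<^sub>R f i"
    using symmetric_matrix_orthonormal_eigenvectors[OF symA] by metis
  obtain g :: "'n \<Rightarrow> real ^ 'n" and d' where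
    g: "\<And>i j. g i \<bullet> g j = (if i = j then 1 else 0)" "\<And>i. B *v g i = d' i *\<^sub>R g i"
    using symmetric_matrix_orthonormal_eigenvectors[OF symB] by metis
  define t where "t = eigenvalues B ! i"
  have count: "size (filter_mset (\<lambda>x. x \<le> s) (image_mset h (mset_set UNIV))) = card {j. h j \<le> s}"
    for h :: "'n \<Rightarrow> real" and s
    by (simp add: filter_mset_image_mset)
  have sorted: "sorted (eigenvalues M)" for M :: "real ^ 'n ^ 'n"
    by (simp add: eigenvalues_def)
  define V where "V = span (f ` {j. t + e < d j})"
  define W where "W = span (g ` {j. d' j \<le> t})"
  have "x = 0" if xV: "x \<in> V" and xW: "x \<in> W" for x
  proof -
    obtain b where b: "x \<bullet> x = (\<Sum>j | d' j \<le> t. (b j)\<^sup>2)" "x \<bullet> (B *v x) = (\<Sum>j | d' j \<le> t. d' j * (b j)\<^sup>2)"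
      using quadratic_form_on_span_of_eigenvectors[OF g xW[unfolded W_def]] by metis
    have B_le: "x \<bullet> (B *v x) \<le> t * (x \<bullet> x)"
      unfolding b sum_distrib_left by (intro sum_mono mult_right_mono) auto
    obtain a where a: "x \<bullet> x = (\<Sum>j | t + e < d j. (a j)\<^sup>2)" "x \<bullet> (A *v x) = (\<Sum>j | t + e < d j. d j * (a j)\<^sup>2)"
      using quadratic_form_on_span_of_eigenvectors[OF f xV[unfolded V_def]] by metis
    have "(\<Sum>j | t + e < d j. (d j - (t + e)) * (a j)\<^sup>2) = x \<bullet> (A *v x) - (t + e) * (x \<bullet> x)"
      by (simp add: a algebra_simps sum_subtractf sum.distrib sum_distrib_left)
    also have "\<dots> \<le> 0" using le[of x] B_le by (simp add: algebra_simps)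
    finally have "(\<Sum>j | t + e < d j. (d j - (t + e)) * (a j)\<^sup>2) \<le> 0" .
    moreover have "(\<Sum>j | t + e < d j. (d j - (t + e)) * (a j)\<^sup>2) \<ge> 0"
      by (intro sum_nonneg) auto
    ultimately have "(\<Sum>j | t + e < d j. (d j - (t + e)) * (a j)\<^sup>2) = 0" by linarith
    then have "\<forall>j\<in>{j. t + e < d j}. (d j - (t + e)) * (a j)\<^sup>2 = 0"
      by (subst (asm) sum_nonneg_eq_0_iff) auto
    then have "x \<bullet> x = 0" by (auto simp: a(1))
    then show "x = 0" by simp
  qed
  then have "V \<inter> W \<subseteq> {0}" by blast
  then have "dim (V \<inter> W) = 0" by simp
  moreover have "dim {x + y |x y. x \<in> V \<and> y \<in> W} \<le> CARD('n)"
    by (rule order_trans[OF dim_subset_UNIV]) simp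
  moreover have "subspace V" "subspace W" by (auto simp: V_def W_def)
  ultimately have "dim V + dim W \<le> CARD('n)"
    using dim_sums_Int[of V W] by linarith
  then have "card {j. t + e < d j} + card {j. d' j \<le> t} \<le> CARD('n)"
    by (simp only: V_def W_def dim_span_orthonormal[OF f(1)] dim_span_orthonormal[OF g(1)])
  moreover have "card {j. t + e < d j} + card {j. d j \<le> t + e} = CARD('n)"
  proof -
    have "{j. t + e < d j} \<union> {j. d j \<le> t + e} = UNIV" by auto
    moreover have "{j. t + e < d j} \<inter> {j. d j \<le> t + e} = {}" by auto
    ultimately show ?thesis using card_Un_disjoint[of "{j. t + e < d j}" "{j. d j \<le> t + e}"] by simp
  qed
  moreover have "i < card {j. d' j \<le> t}"
    using sorted_nth_le_iff_count[OF sorted, of i B t] i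
    by (simp add: length_eigenvalues[OF symB] mset_eigenvalues[OF g] count t_def)
  ultimately have "i < card {j. d j \<le> t + e}" by linarith
  then show ?thesis
    using sorted_nth_le_iff_count[OF sorted, of i A "t + e"] i
    by (simp add: length_eigenvalues[OF symA] mset_eigenvalues[OF f] count t_def)
qed

section \<open>The updated covariance around the Kalman gain\<close>

text \<open>
  The factor \<open>CARD('n)\<close> is not sharp; any constant independent of \<open>x\<close> and \<open>D\<close> serves the purpose
  of a second order estimate.
\<close>
lemma norm_vector_matrix_mult_le:
  fixes D :: "real ^ 'm ^ 'n"
  shows "norm (x v* D) \<le> real CARD('n) * norm x * norm D"
proof -
  have "x v* D = (\<Sum>i\<in>UNIV. x $ i *\<^sub>R D $ i)"
    by (simp add: vector_matrix_mult_def vec_eq_iff)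
  also have "norm \<dots> \<le> (\<Sum>i\<in>UNIV. norm (x $ i *\<^sub>R D $ i))" by (rule norm_sum)
  also have "\<dots> \<le> (\<Sum>i\<in>(UNIV :: 'n set). norm x * norm D)"
    by (intro sum_mono) (auto intro!: mult_mono component_le_norm_cart Finite_Cartesian_Product.norm_nth_le)
  finally show ?thesis by simp
qed

lemma congruence_quadratic_form_bound:
  fixes S :: "real ^ 'm ^ 'm"
  obtains C where
    "\<And>(D :: real ^ 'm ^ 'n) x. \<bar>x \<bullet> ((D ** S ** transpose D) *v x)\<bar> \<le> C * (norm D)\<^sup>2 * (x \<bullet> x)"
proof -
  obtain L where L: "L > 0" "\<And>y. norm (S *v y) \<le> norm y * L"
    using bounded_linear.pos_bounded[OF matrix_vector_mul_bounded_linear[of S]] by blast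
  show thesis
  proof
    fix D :: "real ^ 'm ^ 'n" and x
    define y where "y = x v* D"
    have "x \<bullet> ((D ** S ** transpose D) *v x) = y \<bullet> (S *v y)"
      by (simp add: y_def dot_lmul_matrix flip: matrix_vector_mul_assoc)
    then have "\<bar>x \<bullet> ((D ** S ** transpose D) *v x)\<bar> \<le> norm y * norm (S *v y)"
      by (simp add: Cauchy_Schwarz_ineq2)
    also have "\<dots> \<le> norm y * (norm y * L)" by (intro mult_left_mono L) auto
    also have "\<dots> = L * (norm y)\<^sup>2" by (simp add: power2_eq_square)
    also have "\<dots> \<le> L * (real CARD('n) * norm x * norm D)\<^sup>2"
      using L(1) norm_vector_matrix_mult_le[of x D] by (intro mult_left_mono power_mono) (auto simp: y_def)
    also have "\<dots> = L * (real CARD('n))\<^sup>2 * (norm D)\<^sup>2 * (x \<bullet> x)"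
      by (simp add: power_mult_distrib dot_square_norm mult_ac)
    finally show "\<bar>x \<bullet> ((D ** S ** transpose D) *v x)\<bar> \<le> L * (real CARD('n))\<^sup>2 * (norm D)\<^sup>2 * (x \<bullet> x)" .
  qed
qed

lemma transpose_add: "transpose (A + B) = transpose A + transpose (B :: 'a::plus ^ 'n ^ 'm)"
  by (simp add: transpose_def vec_eq_iff)

lemma transpose_diff: "transpose (A - B) = transpose A - transpose (B :: 'a::minus ^ 'n ^ 'm)"
  by (simp add: transpose_def vec_eq_iff)

lemma transpose_updated_cov:
  assumes "transpose P = P" "transpose R = R"
  shows "transpose (updated_cov P R H K) = updated_cov P R H K"
  using assms by (simp add: updated_cov_def transpose_add matrix_transpose_mul matrix_mul_assoc)

lemma sym_pos_def_invertible:
  assumes "sym_pos_def A"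
  shows "A ** matrix_inv A = mat 1" "matrix_inv A ** A = mat 1"
proof -
  have "x = 0" if "A *v x = 0" for x
    using assms that by (metis inner_zero_right less_irrefl sym_pos_def_def)
  then have "invertible A"
    by (auto simp: invertible_left_inverse matrix_left_invertible_ker)
  then show "A ** matrix_inv A = mat 1" "matrix_inv A ** A = mat 1"
    unfolding invertible_def matrix_inv_def by (metis (mono_tags, lifting) someI_ex)+
qed

lemma sym_pos_def_innovation_cov:
  fixes P :: "real ^ 'n ^ 'n" and R :: "real ^ 'm ^ 'm" and H :: "real ^ 'n ^ 'm"
  assumes "sym_pos_def P" and "sym_pos_def R"
  shows "sym_pos_def (H ** P ** transpose H + R)"
  unfolding sym_pos_def_def
proof (intro conjI allI impI)
  show "transpose (H ** P ** transpose H + R) = H ** P ** transpose H + R"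
    using assms by (simp add: sym_pos_def_def transpose_add matrix_transpose_mul matrix_mul_assoc)
  fix x :: "real ^ 'm" assume "x \<noteq> 0"
  define y where "y = x v* H"
  have "x \<bullet> ((H ** P ** transpose H + R) *v x) = y \<bullet> (P *v y) + x \<bullet> (R *v x)"
    by (simp add: y_def dot_lmul_matrix matrix_vector_mult_add_rdistrib inner_add_right
        flip: matrix_vector_mul_assoc)
  moreover have "y \<bullet> (P *v y) \<ge> 0"
    using assms(1) unfolding sym_pos_def_def by (metis inner_zero_left less_imp_le order_refl)
  ultimately show "x \<bullet> ((H ** P ** transpose H + R) *v x) > 0"
    using assms(2) \<open>x \<noteq> 0\<close> by (simp add: sym_pos_def_def add_nonneg_pos)
qed

text \<open>
  Completing the square. Put \<open>S = H ** P ** transpose H + R\<close>. The gain satisfies \<open>G ** S = P ** transpose H\<close>,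
  so the updated covariance is \<open>P - L ** S ** transpose G - G ** S ** transpose L + L ** S ** transpose L\<close>
  for every \<open>L\<close>, which is a quadratic polynomial in \<open>L\<close> without linear term at \<open>G\<close>.
\<close>
lemma updated_cov_eq_at_gain_plus_congruence:
  fixes P :: "real ^ 'n ^ 'n" and R :: "real ^ 'm ^ 'm" and H :: "real ^ 'n ^ 'm"
  assumes P: "sym_pos_def P" and R: "sym_pos_def R"
  defines "G \<equiv> kalman_gain P R H"
  shows "updated_cov P R H K = updated_cov P R H G
           + (K - G) ** (H ** P ** transpose H + R) ** transpose (K - G)"
proof -
  define S where "S = H ** P ** transpose H + R"
  have S: "sym_pos_def S" unfolding S_def using P R by (rule sym_pos_def_innovation_cov)
  have "G = P ** transpose H ** matrix_inv S"
    by (simp add: G_def kalman_gain_def S_def)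
  then have GS: "G ** S = P ** transpose H"
    by (metis matrix_mul_assoc matrix_mul_rid sym_pos_def_invertible(2)[OF S])
  have SG: "S ** transpose G = H ** P"
    using arg_cong[OF GS, of transpose] P S by (simp add: matrix_transpose_mul sym_pos_def_def)
  have expand: "updated_cov P R H L = P - L ** S ** transpose G - G ** S ** transpose L + L ** S ** transpose L" for L
  proof -
    have "updated_cov P R H L *v x =
      (P - L ** (H ** P) - (P ** transpose H) ** transpose L + L ** S ** transpose L) *v x" for x
      by (simp add: updated_cov_def S_def transpose_diff matrix_transpose_mul algebra_simps
          flip: matrix_vector_mul_assoc)
    then show ?thesis
      by (simp add: matrix_eq matrix_mul_assoc GS flip: SG)
  qed
  show ?thesis
    unfolding S_def[symmetric] expand
    by (simp add: matrix_eq transpose_diff algebra_simps flip: matrix_vector_mul_assoc)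
qed

section \<open>Criticality\<close>
lemma has_derivative_zero_if_quadratic:
  fixes f :: "'a::real_normed_vector \<Rightarrow> real"
  assumes "\<And>x. \<bar>f x - f a\<bar> \<le> C * (norm (x - a))\<^sup>2"
  shows "(f has_derivative (\<lambda>_. 0)) (at a)"
proof -
  have "((\<lambda>h. \<bar>f (a + h) - f a\<bar> / norm h) \<longlongrightarrow> 0) (at 0)"
  proof (rule tendsto_sandwich[of "\<lambda>_. 0"])
    show "\<forall>\<^sub>F h in at 0. \<bar>f (a + h) - f a\<bar> / norm h \<le> C * norm h"
    proof (intro eventuallyI)
      fix h show "\<bar>f (a + h) - f a\<bar> / norm h \<le> C * norm h"
        using assms[of "a + h"] by (cases "h = 0") (auto simp: divide_simps power2_eq_square mult_ac)
    qed
    show "((\<lambda>h. C * norm h) \<longlongrightarrow> 0) (at 0)"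
      by (rule tendsto_eq_intros refl | simp)+
  qed auto
  then show ?thesis by (simp add: has_derivative_at)
qed

text \<open>
  The covariance moves by a symmetric matrix whose quadratic form is of second order in the distance to the
  gain, and by monotonicity, used in both directions, each ordered eigenvalue moves by no more than that.
\<close>
lemma has_derivative_zero_eigenvalue:
  fixes P :: "real ^ 'n ^ 'n" and R :: "real ^ 'm ^ 'm" and H :: "real ^ 'n ^ 'm"
  assumes P: "sym_pos_def P" and R: "sym_pos_def R" and i: "i < CARD('n)"
  shows "((\<lambda>K. eigenvalues (updated_cov P R H K) ! i) has_derivative (\<lambda>_. 0)) (at (kalman_gain P R H))"
proof -
  define S where "S = H ** P ** transpose H + R"
  obtain C where C: "\<And>(D :: real ^ 'm ^ 'n) x.
      \<bar>x \<bullet> ((D ** S ** transpose D) *v x)\<bar> \<le> C * (norm D)\<^sup>2 * (x \<bullet> x)"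
    using congruence_quadratic_form_bound[of S] by metis
  have sym: "transpose (updated_cov P R H K) = updated_cov P R H K" for K
    using P R by (simp add: transpose_updated_cov sym_pos_def_def)
  show ?thesis
  proof (rule has_derivative_zero_if_quadratic)
    fix K
    define D where "D = K - kalman_gain P R H"
    have eq: "updated_cov P R H K = updated_cov P R H (kalman_gain P R H) + D ** S ** transpose D"
      unfolding D_def S_def using P R by (rule updated_cov_eq_at_gain_plus_congruence)
    have form: "x \<bullet> (updated_cov P R H K *v x) = x \<bullet> (updated_cov P R H (kalman_gain P R H) *v x)
        + x \<bullet> ((D ** S ** transpose D) *v x)" for x
      by (simp add: eq matrix_vector_mult_add_rdistrib inner_add_right)
    have "eigenvalues (updated_cov P R H K) ! i
        \<le> eigenvalues (updated_cov P R H (kalman_gain P R H)) ! i + C * (norm D)\<^sup>2"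
      using C[of _ D] form by (intro eigenvalues_le_if_quadratic_form_le sym i) (smt (verit))
    moreover have "eigenvalues (updated_cov P R H (kalman_gain P R H)) ! i
        \<le> eigenvalues (updated_cov P R H K) ! i + C * (norm D)\<^sup>2"
      using C[of _ D] form by (intro eigenvalues_le_if_quadratic_form_le sym i) (smt (verit))
    ultimately show "\<bar>eigenvalues (updated_cov P R H K) ! i
        - eigenvalues (updated_cov P R H (kalman_gain P R H)) ! i\<bar> \<le> C * (norm (K - kalman_gain P R H))\<^sup>2"
      by (simp add: D_def abs_le_iff)
  qed
qed

lemma mpoly_eval_has_derivative_zero:
  fixes Q :: "real mpoly" and f :: "nat \<Rightarrow> 'a::real_normed_vector \<Rightarrow> real"
  assumes "\<And>i. i \<in> mpoly_vars Q \<Longrightarrow> (f i has_derivative (\<lambda>_. 0)) (at a)"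
  shows "((\<lambda>x. mpoly_eval Q (\<lambda>i. f i x)) has_derivative (\<lambda>_. 0)) (at a)"
proof -
  have "((\<lambda>x. Poly_Mapping.lookup Q m * (\<Prod>i\<in>Poly_Mapping.keys m. f i x ^ Poly_Mapping.lookup m i))
      has_derivative (\<lambda>_. 0)) (at a)" if m: "m \<in> Poly_Mapping.keys Q" for m
  proof -
    have "((\<lambda>x. f i x ^ Poly_Mapping.lookup m i) has_derivative (\<lambda>_. 0)) (at a)"
      if "i \<in> Poly_Mapping.keys m" for i
      using has_derivative_power[OF assms[of i]] m that by (auto simp: mpoly_vars_def)
    from has_derivative_mult_right[OF has_derivative_prod[OF this]] show ?thesis by simp
  qed
  from has_derivative_sum[OF this] show ?thesis
    by (simp add: mpoly_eval_def mpoly_subst_def)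
qed

theorem corollary1p3:
  fixes P :: "real ^ 'n ^ 'n" and R :: "real ^ 'm ^ 'm" and H :: "real ^ 'n ^ 'm"
    and Q :: "real mpoly"
  assumes "sym_pos_def P" and "sym_pos_def R"
    and "mpoly_vars Q \<subseteq> {..<CARD('n)}"
    and "symmetric_mpoly CARD('n) Q"
  shows "critical_point
           (\<lambda>K :: real ^ 'm ^ 'n. mpoly_eval Q (\<lambda>i. eigenvalues (updated_cov P R H K) ! i))
           (kalman_gain P R H)"
  unfolding critical_point_def
proof (rule mpoly_eval_has_derivative_zero)
  fix i assume "i \<in> mpoly_vars Q"
  with assms(3) have "i < CARD('n)" by blast
  with assms(1,2) show "((\<lambda>K. eigenvalues (updated_cov P R H K) ! i) has_derivative (\<lambda>_. 0))
      (at (kalman_gain P R H))"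
    by (rule has_derivative_zero_eigenvalue)
qed

end
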